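(* Let $(X,m,\rho)$ be a bounded complete Ahlfors $Q$-regular metric measure space with a fixed dyadic system, let $G$ be the associated graph, $\bar\rho$ the associated length metric on $G$ (extended to the completion $\overline G$), $\partial G=\overline G\setminus G$, and $\flat:\partial G\to X$ the canonical bijection. Then there are constants $0<c\le C<\infty$ such that: (i) for all $\xi,\eta\in\partial G$, $\ c\,\rho(\flat(\xi),\flat(\eta))\le\bar\rho(\xi,\eta)\le C\,\rho(\flat(\xi),\flat(\eta))$; that is, identifying $\partial G$ with $X$ through $\flat$, the restriction of $\bar\rho$ to $X$ is bi-Lipschitz equivalent to $\rho$; (ii) for all $k\ge0$ and all $\alpha,\beta\in I_k$, $\ c\,\rho(z^k_\alpha,z^k_\beta)\le\bar\rho(\alpha,\beta)\le C\,\rho(z^k_\alpha,z^k_\beta)$. The constants do not depend on $\xi,\eta,k,\alpha,\beta$.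
   Context: Ahlfors regularity: $(X,\rho)$ is a complete metric space, $0<\mathrm{diam}(X)<\infty$, $m\ge0$ is Borel, and $c_1r^Q\le m(B(x,r))\le c_2r^Q$ for all $x\in X$, $0\le r\le\mathrm{diam}(X)$, with constants $0<c_1<c_2$, $Q>0$. Dyadic system (exists by a theorem of M. Christ, up to rescaling the distance): constants $\delta\in(0,1)$, $a_0,c_4>0$, index sets $I_k$ ($k\in\mathbb N=\{0,1,\dots\}$), and open sets $Q^k_\alpha\subseteq X$ ($\alpha\in I_k$) with: (i) $m(X\setminus\bigcup_{\alpha\in I_k}Q^k_\alpha)=0$ for all $k$; (ii) if $l\ge k$, $\alpha\in I_k$, $\beta\in I_l$, then $Q^l_\beta\subseteq Q^k_\alpha$ or $Q^l_\beta\cap Q^k_\alpha=\emptyset$, and distinct sets with the same $k$ are disjoint; (iii) for $l>k$ and $\beta\in I_l$ there is a unique $\alpha\in I_k$ with $Q^l_\beta\subseteq Q^k_\alpha$; (iv) $\mathrm{diam}(Q^k_\alpha)\le c_4\delta^k$; (v) $B(z^k_\alpha,a_0\delta^k)\subseteq Q^k_\alpha$ for a distinguished point $z^k_\alpha\in Q^k_\alpha$; moreover $I_0=\{o\}$ and $Q^0_o=X$. Graph $G$: vertices are the pairs $(k,\alpha)$, $\alpha\in I_k$ (written $\alpha$, with level $d(\alpha)=k$ and $Q_\alpha=Q^k_\alpha$). Two distinct vertices $\alpha,\beta$ are joined by an edge if either $d(\beta)=d(\alpha)+1$ and $Q_\beta\subseteq Q_\alpha$ (or with roles interchanged), or $d(\alpha)=d(\beta)=k$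 and there are $x\in Q_\alpha$, $y\in Q_\beta$ with $\rho(x,y)\le\delta^k$. An edge $[\alpha,\beta]$ with $d(\alpha)\le d(\beta)\le d(\alpha)+1$ has length $\delta^{d(\alpha)}$; the length of a path is the sum of the lengths of its edges; $\bar\rho(\alpha,\beta)$ is the infimum of the lengths of paths in $G$ from $\alpha$ to $\beta$. $\overline G$ is the metric completion of $(G,\bar\rho)$. The map $\flat$: if $\xi\in\partial G$ is the class of the $\bar\rho$-Cauchy sequence $\{\alpha_n\}$ (necessarily not eventually constant), then $\flat(\xi)$ is the unique $x\in X$ with $\lim_n\rho(x,Q_{\alpha_n})=0$; it is a well-defined bijection of $\partial G$ onto $X$. *)

theory Defs
  imports "HOL-Analysis.Analysis"
begin

section \<open>Bounded Ahlfors regular spaces and dyadic systems\<close>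

text \<open>
  The space \<open>X\<close> is the universe of a type of class \<open>complete_space\<close>. Boundedness is stated
  separately because \<open>diameter\<close> has an arbitrary value on unbounded sets. Note that
  \<open>0 powr q = 0\<close>, so the condition at \<open>r = 0\<close> holds automatically.
\<close>

definition ahlfors_regular :: "'a::complete_space measure \<Rightarrow> real \<Rightarrow> real \<Rightarrow> real \<Rightarrow> bool" where
  "ahlfors_regular m c1 c2 q \<longleftrightarrow>
     bounded (UNIV :: 'a set) \<and> 0 < diameter (UNIV :: 'a set) \<and>
     sets m = sets borel \<and>
     0 < c1 \<and> c1 < c2 \<and> 0 < q \<and>
     (\<forall>x r. 0 \<le> r \<and> r \<le> diameter (UNIV :: 'a set) \<longrightarrow>
        ennreal (c1 * r powr q) \<le> emeasure m (ball x r) \<and>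
        emeasure m (ball x r) \<le> ennreal (c2 * r powr q))"

text \<open>
  \<open>I k\<close> is the index set of level \<open>k\<close>, \<open>D k \<alpha>\<close> the dyadic set with index \<open>\<alpha>\<close> at level \<open>k\<close>,
  and \<open>z k \<alpha>\<close> its distinguished point.
\<close>

definition dyadic_system ::
  "'a::complete_space measure \<Rightarrow> real \<Rightarrow> real \<Rightarrow> real \<Rightarrow>
   (nat \<Rightarrow> 'i set) \<Rightarrow> (nat \<Rightarrow> 'i \<Rightarrow> 'a set) \<Rightarrow> (nat \<Rightarrow> 'i \<Rightarrow> 'a) \<Rightarrow> bool" where
  "dyadic_system m \<delta> a0 c4 I D z \<longleftrightarrow>
     0 < \<delta> \<and> \<delta> < 1 \<and> 0 < a0 \<and> 0 < c4 \<and>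
     (\<forall>k. \<forall>\<alpha>\<in>I k. open (D k \<alpha>)) \<and>
     (\<forall>k. emeasure m (UNIV - (\<Union>\<alpha>\<in>I k. D k \<alpha>)) = 0) \<and>
     (\<forall>k l. \<forall>\<alpha>\<in>I k. \<forall>\<beta>\<in>I l. k \<le> l \<longrightarrow> D l \<beta> \<subseteq> D k \<alpha> \<or> D l \<beta> \<inter> D k \<alpha> = {}) \<and>
     (\<forall>k. \<forall>\<alpha>\<in>I k. \<forall>\<beta>\<in>I k. \<alpha> \<noteq> \<beta> \<longrightarrow> D k \<alpha> \<inter> D k \<beta> = {}) \<and>
     (\<forall>k l. \<forall>\<beta>\<in>I l. k < l \<longrightarrow> (\<exists>!\<alpha>. \<alpha> \<in> I k \<and> D l \<beta> \<subseteq> D k \<alpha>)) \<and>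
     (\<forall>k. \<forall>\<alpha>\<in>I k. diameter (D k \<alpha>) \<le> c4 * \<delta> ^ k) \<and>
     (\<forall>k. \<forall>\<alpha>\<in>I k. z k \<alpha> \<in> D k \<alpha> \<and> ball (z k \<alpha>) (a0 * \<delta> ^ k) \<subseteq> D k \<alpha>) \<and>
     (\<exists>or. I 0 = {or} \<and> D 0 or = UNIV)"

section \<open>The graph of a dyadic system and its path metric\<close>

definition dy_verts :: "(nat \<Rightarrow> 'i set) \<Rightarrow> (nat \<times> 'i) set" where
  "dy_verts I = {(k, \<alpha>). \<alpha> \<in> I k}"

abbreviation dy_set :: "(nat \<Rightarrow> 'i \<Rightarrow> 'a set) \<Rightarrow> nat \<times> 'i \<Rightarrow> 'a set" where
  "dy_set D v \<equiv> D (fst v) (snd v)"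

definition dy_edge ::
  "real \<Rightarrow> (nat \<Rightarrow> 'i set) \<Rightarrow> (nat \<Rightarrow> 'i \<Rightarrow> 'a::metric_space set) \<Rightarrow> nat \<times> 'i \<Rightarrow> nat \<times> 'i \<Rightarrow> bool" where
  "dy_edge \<delta> I D u v \<longleftrightarrow>
     u \<in> dy_verts I \<and> v \<in> dy_verts I \<and> u \<noteq> v \<and>
     (fst v = fst u + 1 \<and> dy_set D v \<subseteq> dy_set D u \<or>
      fst u = fst v + 1 \<and> dy_set D u \<subseteq> dy_set D v \<or>
      fst u = fst v \<and> (\<exists>x\<in>dy_set D u. \<exists>y\<in>dy_set D v. dist x y \<le> \<delta> ^ fst u))"

definition dy_edge_len :: "real \<Rightarrow> nat \<times> 'i \<Rightarrow> nat \<times> 'i \<Rightarrow> real" where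
  "dy_edge_len \<delta> u v = \<delta> ^ min (fst u) (fst v)"

fun dy_path_len :: "real \<Rightarrow> (nat \<times> 'i) list \<Rightarrow> real" where
  "dy_path_len \<delta> (u # v # p) = dy_edge_len \<delta> u v + dy_path_len \<delta> (v # p)"
| "dy_path_len \<delta> _ = 0"

text \<open>A path is given by its list of vertices; \<open>[u]\<close> is the trivial path at \<open>u\<close>.\<close>

definition dy_paths ::
  "real \<Rightarrow> (nat \<Rightarrow> 'i set) \<Rightarrow> (nat \<Rightarrow> 'i \<Rightarrow> 'a::metric_space set) \<Rightarrow>
   nat \<times> 'i \<Rightarrow> nat \<times> 'i \<Rightarrow> (nat \<times> 'i) list set" where
  "dy_paths \<delta> I D u v =
     {p. p \<noteq> [] \<and> hd p = u \<and> last p = v \<and> set p \<subseteq> dy_verts I \<and> successively (dy_edge \<delta> I D) p}"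

text \<open>
  The value \<open>0\<close> outside the vertex set is immaterial; it is there because the locale
  \<open>Metric_space\<close> requires nonnegativity on the whole type.
\<close>

definition dy_dist ::
  "real \<Rightarrow> (nat \<Rightarrow> 'i set) \<Rightarrow> (nat \<Rightarrow> 'i \<Rightarrow> 'a::metric_space set) \<Rightarrow> nat \<times> 'i \<Rightarrow> nat \<times> 'i \<Rightarrow> real" where
  "dy_dist \<delta> I D u v =
     (if u \<in> dy_verts I \<and> v \<in> dy_verts I
      then INF p\<in>dy_paths \<delta> I D u v. dy_path_len \<delta> p else 0)"

section \<open>Metric completion\<close>

text \<open>
  Points of the completion of \<open>(M, d)\<close> are the classes of Cauchy sequences modulo
  \<open>d (s n) (t n) \<longlonglongrightarrow> 0\<close>; the boundary is what remains after removing the classes of the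
  constant sequences.
\<close>

definition cauchy_rel :: "'v set \<Rightarrow> ('v \<Rightarrow> 'v \<Rightarrow> real) \<Rightarrow> ((nat \<Rightarrow> 'v) \<times> (nat \<Rightarrow> 'v)) set" where
  "cauchy_rel M d =
     {(s, t). Metric_space.MCauchy M d s \<and> Metric_space.MCauchy M d t \<and>
              (\<lambda>n. d (s n) (t n)) \<longlonglongrightarrow> 0}"

definition completion :: "'v set \<Rightarrow> ('v \<Rightarrow> 'v \<Rightarrow> real) \<Rightarrow> (nat \<Rightarrow> 'v) set set" where
  "completion M d = {s. Metric_space.MCauchy M d s} // cauchy_rel M d"

definition completion_emb :: "'v set \<Rightarrow> ('v \<Rightarrow> 'v \<Rightarrow> real) \<Rightarrow> 'v \<Rightarrow> (nat \<Rightarrow> 'v) set" where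
  "completion_emb M d v = cauchy_rel M d `` {\<lambda>_. v}"

definition completion_dist ::
  "'v set \<Rightarrow> ('v \<Rightarrow> 'v \<Rightarrow> real) \<Rightarrow> (nat \<Rightarrow> 'v) set \<Rightarrow> (nat \<Rightarrow> 'v) set \<Rightarrow> real" where
  "completion_dist M d \<xi> \<eta> = (THE L. \<forall>s\<in>\<xi>. \<forall>t\<in>\<eta>. (\<lambda>n. d (s n) (t n)) \<longlonglongrightarrow> L)"

definition completion_boundary :: "'v set \<Rightarrow> ('v \<Rightarrow> 'v \<Rightarrow> real) \<Rightarrow> (nat \<Rightarrow> 'v) set set" where
  "completion_boundary M d = completion M d - completion_emb M d ` M"

abbreviation dy_boundary ::
  "real \<Rightarrow> (nat \<Rightarrow> 'i set) \<Rightarrow> (nat \<Rightarrow> 'i \<Rightarrow> 'a::metric_space set) \<Rightarrow> (nat \<Rightarrow> nat \<times> 'i) set set" where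
  "dy_boundary \<delta> I D \<equiv> completion_boundary (dy_verts I) (dy_dist \<delta> I D)"

abbreviation dy_cdist ::
  "real \<Rightarrow> (nat \<Rightarrow> 'i set) \<Rightarrow> (nat \<Rightarrow> 'i \<Rightarrow> 'a::metric_space set) \<Rightarrow>
   (nat \<Rightarrow> nat \<times> 'i) set \<Rightarrow> (nat \<Rightarrow> nat \<times> 'i) set \<Rightarrow> real" where
  "dy_cdist \<delta> I D \<equiv> completion_dist (dy_verts I) (dy_dist \<delta> I D)"

definition dy_flat ::
  "(nat \<Rightarrow> 'i \<Rightarrow> 'a::metric_space set) \<Rightarrow> (nat \<Rightarrow> nat \<times> 'i) set \<Rightarrow> 'a" where
  "dy_flat D \<xi> = (THE x. \<forall>s\<in>\<xi>. (\<lambda>n. infdist x (dy_set D (s n))) \<longlonglongrightarrow> 0)"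

section \<open>The path metric is a metric\<close>

lemma dy_edge_sym: "dy_edge \<delta> I D u v \<Longrightarrow> dy_edge \<delta> I D v u"
  unfolding dy_edge_def by (metis dist_commute)

lemma dy_path_len_append:
  "dy_path_len \<delta> (p @ u # q) = dy_path_len \<delta> (p @ [u]) + dy_path_len \<delta> (u # q)"
proof (induction p)
  case (Cons a p)
  then show ?case by (cases p) auto
qed simp

lemma dy_path_len_rev: "dy_path_len \<delta> (rev p) = dy_path_len \<delta> p"
proof (induction p)
  case (Cons a p)
  show ?case
  proof (cases p)
    case (Cons b q)
    then have "dy_path_len \<delta> (rev (a # p)) = dy_path_len \<delta> (rev p) + dy_edge_len \<delta> b a"
      using dy_path_len_append[of \<delta> "rev q" b "[a]"] by simp
    then show ?thesis
      using Cons.IH Cons by (simp add: dy_edge_len_def min.commute)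
  qed simp
qed simp

lemma dy_path_len_nonneg: "0 < \<delta> \<Longrightarrow> 0 \<le> dy_path_len \<delta> p"
  by (induction \<delta> p rule: dy_path_len.induct) (auto simp: dy_edge_len_def)

lemma dy_paths_rev: "p \<in> dy_paths \<delta> I D u v \<Longrightarrow> rev p \<in> dy_paths \<delta> I D v u"
  unfolding dy_paths_def
  by (auto simp: hd_rev last_rev intro: successively_mono dy_edge_sym)

lemma dy_paths_trans:
  assumes "p \<in> dy_paths \<delta> I D u v" "q \<in> dy_paths \<delta> I D v w"
  shows "\<exists>r\<in>dy_paths \<delta> I D u w. dy_path_len \<delta> r = dy_path_len \<delta> p + dy_path_len \<delta> q"
proof -
  obtain p' where p: "p = p' @ [v]"
    using assms(1) by (auto simp: dy_paths_def) (metis append_butlast_last_id)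
  obtain q' where q: "q = v # q'"
    using assms(2) by (auto simp: dy_paths_def) (metis list.collapse)
  have "p' @ v # q' \<in> dy_paths \<delta> I D u w"
    using assms unfolding p q dy_paths_def
    by (auto simp: successively_append_iff successively_Cons hd_append)
  then show ?thesis
    using dy_path_len_append[of \<delta> p' v q'] p q by blast
qed

lemma dy_paths_nonempty:
  assumes D: "dyadic_system m \<delta> a0 c4 I D z" and "u \<in> dy_verts I" "v \<in> dy_verts I"
  shows "dy_paths \<delta> I D u v \<noteq> {}"
proof -
  obtain or where o: "I 0 = {or}"
    using D unfolding dyadic_system_def by (elim conjE exE)
  have *: "dy_paths \<delta> I D (k, \<alpha>) (0, or) \<noteq> {}" if "\<alpha> \<in> I k" for k \<alpha>
    using that
  proof (induction k arbitrary: \<alpha>)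
    case 0
    then have "[(0, or)] \<in> dy_paths \<delta> I D (0, \<alpha>) (0, or)"
      using o by (auto simp: dy_paths_def dy_verts_def)
    then show ?case by blast
  next
    case (Suc k)
    have "\<forall>k l. \<forall>\<beta>\<in>I l. k < l \<longrightarrow> (\<exists>!\<alpha>. \<alpha> \<in> I k \<and> D l \<beta> \<subseteq> D k \<alpha>)"
      using D unfolding dyadic_system_def by (elim conjE) assumption
    from this[rule_format, OF Suc.prems lessI] obtain \<gamma>
      where g: "\<gamma> \<in> I k" "D (Suc k) \<alpha> \<subseteq> D k \<gamma>"
      by (elim ex1E conjE)
    have "[(Suc k, \<alpha>), (k, \<gamma>)] \<in> dy_paths \<delta> I D (Suc k, \<alpha>) (k, \<gamma>)"
      using g Suc.prems by (auto simp: dy_paths_def dy_verts_def dy_edge_def)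
    then show ?case
      using Suc.IH[OF g(1)] dy_paths_trans by blast
  qed
  have "dy_paths \<delta> I D u (0, or) \<noteq> {}" "dy_paths \<delta> I D v (0, or) \<noteq> {}"
    using * assms(2,3) by (auto simp: dy_verts_def)
  then show ?thesis
    using dy_paths_rev dy_paths_trans by blast
qed

lemma dy_dist_le:
  assumes "0 < \<delta>" "p \<in> dy_paths \<delta> I D u v" "u \<in> dy_verts I" "v \<in> dy_verts I"
  shows "dy_dist \<delta> I D u v \<le> dy_path_len \<delta> p"
  using assms unfolding dy_dist_def
  by (auto intro!: cINF_lower bdd_belowI2[where m = 0] dy_path_len_nonneg)

lemma Metric_space_dy_dist:
  assumes D: "dyadic_system m \<delta> a0 c4 I D z"
  shows "Metric_space (dy_verts I) (dy_dist \<delta> I D)"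
proof
  have \<delta>: "0 < \<delta>" "\<delta> < 1"
    using D by (auto simp: dyadic_system_def)
  note ne = dy_paths_nonempty[OF D]
  show nonneg: "0 \<le> dy_dist \<delta> I D u v" for u v
  proof (cases "u \<in> dy_verts I \<and> v \<in> dy_verts I")
    case True
    then show ?thesis
      unfolding dy_dist_def using ne[of u v] \<delta>
      by (simp add: cINF_greatest dy_path_len_nonneg)
  qed (auto simp: dy_dist_def)
  show "dy_dist \<delta> I D u v = dy_dist \<delta> I D v u" for u v
  proof -
    have "dy_path_len \<delta> ` dy_paths \<delta> I D u v \<subseteq> dy_path_len \<delta> ` dy_paths \<delta> I D v u" for u v
    proof clarify
      fix p assume "p \<in> dy_paths \<delta> I D u v"
      then have "rev p \<in> dy_paths \<delta> I D v u"
        by (rule dy_paths_rev)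
      then show "dy_path_len \<delta> p \<in> dy_path_len \<delta> ` dy_paths \<delta> I D v u"
        using dy_path_len_rev[of \<delta> p] by (metis imageI)
    qed
    then show ?thesis
      unfolding dy_dist_def by (metis subset_antisym)
  qed
  show "dy_dist \<delta> I D u v = 0 \<longleftrightarrow> u = v" if uv: "u \<in> dy_verts I" "v \<in> dy_verts I" for u v
  proof
    assume "u = v"
    then have "[u] \<in> dy_paths \<delta> I D u v"
      using uv by (auto simp: dy_paths_def)
    from dy_dist_le[OF \<delta>(1) this uv] have "dy_dist \<delta> I D u v \<le> 0"
      by simp
    then show "dy_dist \<delta> I D u v = 0"
      using nonneg[of u v] by simp
  next
    assume 0: "dy_dist \<delta> I D u v = 0"
    show "u = v"
    proof (rule ccontr)
      assume "u \<noteq> v"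
      have "\<delta> ^ fst u \<le> dy_path_len \<delta> p" if p: "p \<in> dy_paths \<delta> I D u v" for p
      proof -
        obtain w q where q: "p = u # w # q"
          using p \<open>u \<noteq> v\<close> unfolding dy_paths_def by (cases p; cases "tl p") auto
        have "\<delta> ^ fst u \<le> dy_edge_len \<delta> u w"
          unfolding dy_edge_len_def using \<delta> by (intro power_decreasing) auto
        then show ?thesis
          using dy_path_len_nonneg[OF \<delta>(1), of "w # q"] by (simp add: q)
      qed
      then have "\<delta> ^ fst u \<le> dy_dist \<delta> I D u v"
        unfolding dy_dist_def using ne[OF uv] uv by (simp add: cINF_greatest)
      then show False
        using 0 zero_less_power[OF \<delta>(1), of "fst u"] by simp
    qed
  qed
  show "dy_dist \<delta> I D u w \<le> dy_dist \<delta> I D u v + dy_dist \<delta> I D v w"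
    if V: "u \<in> dy_verts I" "v \<in> dy_verts I" "w \<in> dy_verts I" for u v w
  proof -
    have 1: "dy_dist \<delta> I D u w \<le> dy_path_len \<delta> p + dy_path_len \<delta> q"
      if "p \<in> dy_paths \<delta> I D u v" "q \<in> dy_paths \<delta> I D v w" for p q
      using dy_paths_trans[OF that] dy_dist_le[OF \<delta>(1) _ V(1,3)] by metis
    have 2: "dy_dist \<delta> I D u w - dy_path_len \<delta> p \<le> dy_dist \<delta> I D v w"
      if "p \<in> dy_paths \<delta> I D u v" for p
    proof -
      have "dy_dist \<delta> I D u w - dy_path_len \<delta> p \<le> (INF q\<in>dy_paths \<delta> I D v w. dy_path_len \<delta> q)"
        using ne[OF V(2,3)] 1[OF that] by (intro cINF_greatest) (auto simp: algebra_simps)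
      then show ?thesis using V by (simp add: dy_dist_def)
    qed
    have "dy_dist \<delta> I D u w - dy_dist \<delta> I D v w \<le> (INF p\<in>dy_paths \<delta> I D u v. dy_path_len \<delta> p)"
      using ne[OF V(1,2)] 2 by (intro cINF_greatest) (auto simp: algebra_simps)
    moreover have "\<dots> = dy_dist \<delta> I D u v"
      using V by (simp add: dy_dist_def)
    ultimately show ?thesis by simp
  qed
qed

end

theory Submission
  imports Defs
begin

text \<open>
  Write \<open>z\<^sub>v\<close> for the distinguished point and \<open>l\<^sub>v\<close> for the level of a vertex \<open>v\<close>. The endpoints of
  an edge of length \<open>L\<close> have distinguished points at distance at most \<open>(2 c\<^sub>4 + 1) L\<close>, so
  \<open>v \<mapsto> z\<^sub>v\<close> is Lipschitz. Conversely, if \<open>\<rho>(z\<^sub>u, z\<^sub>v) + \<delta>\<^bsup>l\<^sub>u\<^esup> + \<delta>\<^bsup>l\<^sub>v\<^esup>\<close> is comparable to \<open>\<delta>\<^bsup>j\<^esup>\<close>,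
  then the ancestors of \<open>u\<close> and \<open>v\<close> at level \<open>j\<close> coincide or are neighbours, and climbing to
  them costs at most a geometric series \<open>\<delta>\<^bsup>j\<^esup> / (1 - \<delta>)\<close>; hence the graph distance is bounded by a
  multiple of that sum. On one level, distinct dyadic sets have \<open>\<rho>(z\<^sub>u, z\<^sub>v) \<ge> a\<^sub>0 \<delta>\<^bsup>k\<^esup>\<close>, which absorbs
  the last two terms. Since every vertex \<open>v\<close> is isolated with radius \<open>\<delta>\<^bsup>l\<^sub>v\<^esup>\<close>, a Cauchy sequence that
  defines a boundary point has levels tending to infinity, so there the last two terms vanish
  in the limit.
\<close>

section \<open>The completion of a metric space\<close>

context Metric_space
begin

lemma d_diff_le:
  assumes "a \<in> M" "b \<in> M" "a' \<in> M" "b' \<in> M"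
  shows "\<bar>d a b - d a' b'\<bar> \<le> d a a' + d b b'"
  using triangle[of a a' b] triangle[of a' b' b] triangle[of a' a b'] triangle[of a b b']
    commute[of a a'] commute[of b b'] assms by linarith

lemma equiv_cauchy_rel: "equiv {s. MCauchy s} (cauchy_rel M d)"
proof (rule equivI)
  show "cauchy_rel M d \<subseteq> {s. MCauchy s} \<times> {s. MCauchy s}"
    by (auto simp: cauchy_rel_def)
  show "refl_on {s. MCauchy s} (cauchy_rel M d)"
  proof (rule refl_onI)
    fix s assume s: "s \<in> {s. MCauchy s}"
    then have "s n \<in> M" for n
      by (auto simp: MCauchy_def)
    with s show "(s, s) \<in> cauchy_rel M d"
      by (simp add: cauchy_rel_def)
  qed
  show "sym (cauchy_rel M d)"
    by (rule symI) (simp add: cauchy_rel_def commute)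
  show "trans (cauchy_rel M d)"
  proof (rule transI)
    fix s t u assume st: "(s, t) \<in> cauchy_rel M d" and tu: "(t, u) \<in> cauchy_rel M d"
    then have M: "s n \<in> M" "t n \<in> M" "u n \<in> M" for n
      by (auto simp: cauchy_rel_def MCauchy_def)
    have "(\<lambda>n. d (s n) (t n) + d (t n) (u n)) \<longlonglongrightarrow> 0"
      using tendsto_add[of _ 0 _ _ 0] st tu by (force simp: cauchy_rel_def)
    then have "(\<lambda>n. d (s n) (u n)) \<longlonglongrightarrow> 0"
      by (rule tendsto_sandwich[OF _ _ tendsto_const, rotated 2]) (auto simp: M triangle)
    with st tu show "(s, u) \<in> cauchy_rel M d"
      by (simp add: cauchy_rel_def)
  qed
qed

lemma completion_rel:
  assumes "\<xi> \<in> completion M d" "s \<in> \<xi>" "t \<in> \<xi>"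
  shows "MCauchy s" "(\<lambda>n. d (s n) (t n)) \<longlonglongrightarrow> 0"
  using in_quotient_imp_in_rel[OF equiv_cauchy_rel, of \<xi> s t] assms
  by (auto simp: completion_def cauchy_rel_def)

lemma completion_nonempty: "\<xi> \<in> completion M d \<Longrightarrow> \<exists>s. s \<in> \<xi>"
  using in_quotient_imp_non_empty[OF equiv_cauchy_rel] by (auto simp: completion_def)

lemma completion_in_M: "\<xi> \<in> completion M d \<Longrightarrow> s \<in> \<xi> \<Longrightarrow> s n \<in> M"
  using completion_rel(1) unfolding MCauchy_def by blast

lemma completion_eqI:
  assumes "\<xi> \<in> completion M d" "\<eta> \<in> completion M d" "s \<in> \<xi>" "t \<in> \<eta>"
    and "(\<lambda>n. d (s n) (t n)) \<longlonglongrightarrow> 0"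
  shows "\<xi> = \<eta>"
proof -
  have "(s, t) \<in> cauchy_rel M d"
    using assms completion_rel(1) by (auto simp: cauchy_rel_def)
  then show ?thesis
    using quotient_eq_iff[OF equiv_cauchy_rel] assms by (auto simp: completion_def)
qed

lemma completion_classI:
  assumes "MCauchy s"
  shows "cauchy_rel M d `` {s} \<in> completion M d" "s \<in> cauchy_rel M d `` {s}"
  using assms equiv_class_self[OF equiv_cauchy_rel, of s]
  by (auto simp: completion_def intro: quotientI)

lemma completion_emb_mem:
  assumes "v \<in> M"
  shows "completion_emb M d v \<in> completion M d" "(\<lambda>_. v) \<in> completion_emb M d v"
proof -
  have "MCauchy (\<lambda>_. v)"
    using assms by (auto simp: MCauchy_def)
  from completion_classI[OF this]
  show "completion_emb M d v \<in> completion M d" "(\<lambda>_. v) \<in> completion_emb M d v"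
    by (simp_all only: completion_emb_def)
qed

text \<open>By the quadrilateral inequality \<open>d_diff_le\<close> the real sequence of distances
  is Cauchy, so completeness of the reals suffices.\<close>

lemma convergent_dist_MCauchy:
  assumes "MCauchy s" "MCauchy t"
  shows "convergent (\<lambda>n. d (s n) (t n))"
proof -
  have M: "s n \<in> M" "t n \<in> M" for n
    using assms by (auto simp: MCauchy_def)
  have "Cauchy (\<lambda>n. d (s n) (t n))"
  proof (rule metric_CauchyI)
    fix e :: real assume "0 < e"
    then obtain N1 N2 where
      N1: "\<And>k n. \<lbrakk>N1 \<le> k; N1 \<le> n\<rbrakk> \<Longrightarrow> d (s k) (s n) < e / 2" and
      N2: "\<And>k n. \<lbrakk>N2 \<le> k; N2 \<le> n\<rbrakk> \<Longrightarrow> d (t k) (t n) < e / 2"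
      using assms unfolding MCauchy_def by (metis half_gt_zero)
    have "dist (d (s k) (t k)) (d (s n) (t n)) < e" if "k \<ge> max N1 N2" "n \<ge> max N1 N2" for k n
      using d_diff_le[of "s k" "t k" "s n" "t n"] N1[of k n] N2[of k n] that M
      by (simp add: dist_real_def)
    then show "\<exists>N. \<forall>k\<ge>N. \<forall>n\<ge>N. dist (d (s k) (t k)) (d (s n) (t n)) < e"
      by blast
  qed
  then show ?thesis
    by (rule Cauchy_convergent)
qed

text \<open>This justifies the definite description in \<open>completion_dist\<close>: changing
  representatives alters the distances by a null sequence, so the limit depends on the classes
  only.\<close>

lemma completion_dist_LIMSEQ:
  assumes \<xi>: "\<xi> \<in> completion M d" and \<eta>: "\<eta> \<in> completion M d" and "s \<in> \<xi>" "t \<in> \<eta>"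
  shows "(\<lambda>n. d (s n) (t n)) \<longlonglongrightarrow> completion_dist M d \<xi> \<eta>"
proof -
  obtain L where L: "(\<lambda>n. d (s n) (t n)) \<longlonglongrightarrow> L"
    using convergent_dist_MCauchy completion_rel(1) assms by (metis convergentD)
  have *: "\<forall>s'\<in>\<xi>. \<forall>t'\<in>\<eta>. (\<lambda>n. d (s' n) (t' n)) \<longlonglongrightarrow> L"
  proof (intro ballI)
    fix s' t' assume "s' \<in> \<xi>" "t' \<in> \<eta>"
    then have M: "s n \<in> M" "t n \<in> M" "s' n \<in> M" "t' n \<in> M" for n
      using completion_in_M assms by blast+
    have "(\<lambda>n. d (s' n) (s n) + d (t' n) (t n)) \<longlonglongrightarrow> 0"
      using completion_rel(2) assms \<open>s' \<in> \<xi>\<close> \<open>t' \<in> \<eta>\<close> by (intro tendsto_add_zero) metis+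
    then have "(\<lambda>n. d (s' n) (t' n) - d (s n) (t n)) \<longlonglongrightarrow> 0"
      by (rule Lim_null_comparison[OF always_eventually, rotated])
        (simp add: M d_diff_le)
    from tendsto_add[OF this L] show "(\<lambda>n. d (s' n) (t' n)) \<longlonglongrightarrow> L"
      by simp
  qed
  have "completion_dist M d \<xi> \<eta> = L"
    unfolding completion_dist_def
    using * assms(3,4) L by (intro the_equality) (blast, metis LIMSEQ_unique)
  with L show ?thesis by simp
qed

end

section \<open>Comparison of the two distances\<close>

locale dyadic_space =
  fixes m :: "'a::complete_space measure"
    and c1 c2 q \<delta> a0 c4 :: real
    and I :: "nat \<Rightarrow> 'i set"
    and D :: "nat \<Rightarrow> 'i \<Rightarrow> 'a set"
    and z :: "nat \<Rightarrow> 'i \<Rightarrow> 'a"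
  assumes ahlfors: "ahlfors_regular m c1 c2 q"
    and dyadic: "dyadic_system m \<delta> a0 c4 I D z"
begin

abbreviation verts where "verts \<equiv> dy_verts I"
abbreviation gdist where "gdist \<equiv> dy_dist \<delta> I D"
abbreviation center where "center v \<equiv> z (fst v) (snd v)"

sublocale G: Metric_space verts gdist
  by (rule Metric_space_dy_dist[OF dyadic])

lemma params: "0 < \<delta>" "\<delta> < 1" "0 < a0" "0 < c4"
  using dyadic unfolding dyadic_system_def by - (elim conjE, assumption)+

lemma dyadic_props:
  shows dyadic_open: "\<forall>k. \<forall>\<alpha>\<in>I k. open (D k \<alpha>)"
    and dyadic_null: "\<forall>k. emeasure m (UNIV - (\<Union>\<alpha>\<in>I k. D k \<alpha>)) = 0"
    and dyadic_disjoint: "\<forall>k. \<forall>\<alpha>\<in>I k. \<forall>\<beta>\<in>I k. \<alpha> \<noteq> \<beta> \<longrightarrow> D k \<alpha> \<inter> D k \<beta> = {}"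
    and dyadic_parent: "\<forall>k l. \<forall>\<beta>\<in>I l. k < l \<longrightarrow> (\<exists>!\<alpha>. \<alpha> \<in> I k \<and> D l \<beta> \<subseteq> D k \<alpha>)"
    and dyadic_diam: "\<forall>k. \<forall>\<alpha>\<in>I k. diameter (D k \<alpha>) \<le> c4 * \<delta> ^ k"
    and dyadic_center: "\<forall>k. \<forall>\<alpha>\<in>I k. z k \<alpha> \<in> D k \<alpha> \<and> ball (z k \<alpha>) (a0 * \<delta> ^ k) \<subseteq> D k \<alpha>"
    and dyadic_root: "\<exists>or. I 0 = {or} \<and> D 0 or = UNIV"
  using dyadic unfolding dyadic_system_def by - (elim conjE, assumption)+

section \<open>Size, separation and density of the dyadic sets\<close>

lemma center_in: "v \<in> verts \<Longrightarrow> center v \<in> dy_set D v"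
  using dyadic_center by (auto simp: dy_verts_def)

lemma dist_le_diam:
  assumes "v \<in> verts" "x \<in> dy_set D v" "y \<in> dy_set D v"
  shows "dist x y \<le> c4 * \<delta> ^ fst v"
proof -
  have "bounded (dy_set D v)"
    using ahlfors bounded_subset by (auto simp: ahlfors_regular_def)
  then have "dist x y \<le> diameter (dy_set D v)"
    using assms by (intro diameter_bounded_bound) auto
  also have "\<dots> \<le> c4 * \<delta> ^ fst v"
    using dyadic_diam assms(1) by (auto simp: dy_verts_def)
  finally show ?thesis .
qed

text \<open>The ball around one distinguished point stays in its own dyadic set, which is disjoint
  from the set containing the other point.\<close>

lemma center_separated:
  assumes "\<alpha> \<in> I k" "\<beta> \<in> I k" "\<alpha> \<noteq> \<beta>"
  shows "a0 * \<delta> ^ k \<le> dist (z k \<alpha>) (z k \<beta>)"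
proof -
  have "ball (z k \<alpha>) (a0 * \<delta> ^ k) \<subseteq> D k \<alpha>" "z k \<beta> \<in> D k \<beta>" "D k \<alpha> \<inter> D k \<beta> = {}"
    using dyadic_center dyadic_disjoint assms by blast+
  then have "z k \<beta> \<notin> ball (z k \<alpha>) (a0 * \<delta> ^ k)"
    by blast
  then show ?thesis
    by simp
qed

text \<open>Ahlfors regularity gives every ball positive mass, while the points missed by level
  \<open>k\<close> form a null set and so contain no ball.\<close>

lemma dyadic_dense:
  assumes "0 < e"
  shows "\<exists>\<alpha>\<in>I k. \<exists>y\<in>D k \<alpha>. dist x y < e"
proof (rule ccontr)
  assume contra: "\<not> ?thesis"
  \<comment> \<open>The mass bound is assumed only for radii up to the diameter, hence the cap; the
    diameter is positive, so \<open>r\<close> is too.\<close>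
  define r where "r = min e (diameter (UNIV :: 'a set))"
  have r: "0 < r" "r \<le> e" "r \<le> diameter (UNIV :: 'a set)"
    using ahlfors assms by (auto simp: r_def ahlfors_regular_def)
  have sub: "ball x r \<subseteq> UNIV - (\<Union>\<alpha>\<in>I k. D k \<alpha>)"
    using contra r by force
  have "open (\<Union>\<alpha>\<in>I k. D k \<alpha>)"
    using dyadic_open by blast
  then have "UNIV - (\<Union>\<alpha>\<in>I k. D k \<alpha>) \<in> sets m"
    using ahlfors by (auto simp: ahlfors_regular_def)
  with sub have "emeasure m (ball x r) \<le> emeasure m (UNIV - (\<Union>\<alpha>\<in>I k. D k \<alpha>))"
    by (rule emeasure_mono)
  also have "\<dots> = 0"
    using dyadic_null by blast
  finally have "emeasure m (ball x r) = 0"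
    by simp
  moreover have "ennreal (c1 * r powr q) \<le> emeasure m (ball x r)"
    using ahlfors r by (auto simp: ahlfors_regular_def)
  moreover have "0 < c1 * r powr q"
    using ahlfors r by (auto simp: ahlfors_regular_def)
  ultimately show False
    by (simp add: ennreal_eq_0_iff)
qed

text \<open>On a vertical edge both points lie in the larger set, at the cost of one diameter. On a
  horizontal edge the detour through two nearby points costs two diameters and one gap, whence
  \<open>2 * c4 + 1\<close>.\<close>

lemma center_dist_edge:
  assumes "dy_edge \<delta> I D u v"
  shows "dist (center u) (center v) \<le> (2 * c4 + 1) * dy_edge_len \<delta> u v"
proof -
  have uv: "u \<in> verts" "v \<in> verts"
    using assms by (auto simp: dy_edge_def)
  have pos: "0 < dy_edge_len \<delta> u v"
    using params by (simp add: dy_edge_len_def)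
  consider "fst v = fst u + 1" "dy_set D v \<subseteq> dy_set D u"
    | "fst u = fst v + 1" "dy_set D u \<subseteq> dy_set D v"
    | x y where "fst u = fst v" "x \<in> dy_set D u" "y \<in> dy_set D v" "dist x y \<le> \<delta> ^ fst u"
    using assms by (auto simp: dy_edge_def)
  then have "dist (center u) (center v) \<le> c4 * dy_edge_len \<delta> u v \<or>
      dist (center u) (center v) \<le> (2 * c4 + 1) * dy_edge_len \<delta> u v"
  proof cases
    case 1
    then show ?thesis
      using dist_le_diam[OF uv(1), of "center u" "center v"] center_in[OF uv(1)] center_in[OF uv(2)]
      by (auto simp: dy_edge_len_def)
  next
    case 2
    then show ?thesis
      using dist_le_diam[OF uv(2), of "center u" "center v"] center_in[OF uv(1)] center_in[OF uv(2)]
      by (auto simp: dy_edge_len_def)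
  next
    case (3 x y)
    have "dist (center u) (center v) \<le> dist (center u) x + dist x y + dist y (center v)"
      using dist_triangle[of "center u" "center v" x] dist_triangle[of x "center v" y] by linarith
    also have "\<dots> \<le> c4 * \<delta> ^ fst u + \<delta> ^ fst u + c4 * \<delta> ^ fst u"
      using 3 dist_le_diam[OF uv(1), of "center u" x] dist_le_diam[OF uv(2), of y "center v"]
        center_in[OF uv(1)] center_in[OF uv(2)] by auto
    also have "\<dots> = (2 * c4 + 1) * dy_edge_len \<delta> u v"
      using 3 by (simp add: dy_edge_len_def algebra_simps)
    finally show ?thesis ..
  qed
  moreover have "c4 * dy_edge_len \<delta> u v \<le> (2 * c4 + 1) * dy_edge_len \<delta> u v"
    using pos params by (intro mult_right_mono) auto
  ultimately show ?thesis
    by linarith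
qed

lemma center_dist_path:
  assumes "p \<noteq> []" "successively (dy_edge \<delta> I D) p"
  shows "dist (center (hd p)) (center (last p)) \<le> (2 * c4 + 1) * dy_path_len \<delta> p"
  using assms
proof (induction \<delta>\<equiv>\<delta> p rule: dy_path_len.induct)
  case (1 u v p)
  have "dist (center u) (center (last (v # p)))
      \<le> dist (center u) (center v) + dist (center v) (center (last (v # p)))"
    by (rule dist_triangle)
  also have "\<dots> \<le> (2 * c4 + 1) * dy_edge_len \<delta> u v + (2 * c4 + 1) * dy_path_len \<delta> (v # p)"
    using 1 center_dist_edge[of u v] by (intro add_mono) auto
  finally show ?case
    by (simp add: algebra_simps)
qed auto

lemma center_lipschitz:
  assumes "u \<in> verts" "v \<in> verts"
  shows "dist (center u) (center v) \<le> (2 * c4 + 1) * gdist u v"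
proof -
  have K: "0 < 2 * c4 + 1"
    using params by simp
  \<comment> \<open>The constant is divided out so that the left side is a lower bound for the path
    lengths themselves and passes to their infimum.\<close>
  have "dist (center u) (center v) / (2 * c4 + 1) \<le> (INF p\<in>dy_paths \<delta> I D u v. dy_path_len \<delta> p)"
  proof (rule cINF_greatest)
    fix p assume "p \<in> dy_paths \<delta> I D u v"
    then show "dist (center u) (center v) / (2 * c4 + 1) \<le> dy_path_len \<delta> p"
      using center_dist_path[of p] K by (auto simp: dy_paths_def field_simps)
  qed (use dy_paths_nonempty[OF dyadic assms] in simp)
  then show ?thesis
    using assms K by (simp add: dy_dist_def field_simps)
qed

section \<open>Bounds for the graph distance\<close>

lemma gdist_edge:
  assumes "dy_edge \<delta> I D u v"
  shows "gdist u v \<le> \<delta> ^ min (fst u) (fst v)"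
proof -
  have "[u, v] \<in> dy_paths \<delta> I D u v" "u \<in> verts" "v \<in> verts"
    using assms by (auto simp: dy_paths_def dy_edge_def)
  from dy_dist_le[OF params(1) this] show ?thesis
    by (simp add: dy_edge_len_def)
qed

text \<open>A path from \<open>u\<close> to another vertex begins with an edge at \<open>u\<close>,
  whose length is a power of \<delta> with exponent at most \<open>fst u\<close>.\<close>

lemma gdist_isolated:
  assumes "u \<in> verts" "v \<in> verts" "u \<noteq> v"
  shows "\<delta> ^ fst u \<le> gdist u v"
proof -
  have "\<delta> ^ fst u \<le> dy_path_len \<delta> p" if p: "p \<in> dy_paths \<delta> I D u v" for p
  proof -
    obtain w r where r: "p = u # w # r"
      using p \<open>u \<noteq> v\<close> unfolding dy_paths_def by (cases p; cases "tl p") auto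
    have "\<delta> ^ fst u \<le> dy_edge_len \<delta> u w"
      unfolding dy_edge_len_def using params by (intro power_decreasing) auto
    then show ?thesis
      using dy_path_len_nonneg[OF params(1), of "w # r"] by (simp add: r)
  qed
  then show ?thesis
    unfolding dy_dist_def using dy_paths_nonempty[OF dyadic assms(1,2)] assms
    by (simp add: cINF_greatest)
qed

lemma parent_exists:
  assumes "\<alpha> \<in> I (Suc k)"
  shows "\<exists>\<gamma>\<in>I k. D (Suc k) \<alpha> \<subseteq> D k \<gamma>"
  using dyadic_parent[rule_format, OF assms lessI] by blast

text \<open>The bound is the exact geometric sum of the edge lengths from level \<open>k\<close> up
  to level \<open>j\<close>. The subtracted term is what lets the induction close; the cruder
  \<open>\<delta> ^ j / (1 - \<delta>)\<close> would not survive adding an edge.\<close>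

lemma ancestor_exists:
  assumes "\<alpha> \<in> I k" "j \<le> k"
  shows "\<exists>\<gamma>\<in>I j. D k \<alpha> \<subseteq> D j \<gamma> \<and> gdist (k, \<alpha>) (j, \<gamma>) \<le> (\<delta> ^ j - \<delta> ^ k) / (1 - \<delta>)"
  using assms(2,1)
proof (induction k arbitrary: \<alpha> rule: dec_induct)
  case base
  then have "gdist (j, \<alpha>) (j, \<alpha>) = 0"
    by (simp add: dy_verts_def)
  with base show ?case
    by auto
next
  case (step k)
  obtain \<beta> where \<beta>: "\<beta> \<in> I k" "D (Suc k) \<alpha> \<subseteq> D k \<beta>"
    using parent_exists[OF step.prems] by blast
  obtain \<gamma> where \<gamma>: "\<gamma> \<in> I j" "D k \<beta> \<subseteq> D j \<gamma>"
    "gdist (k, \<beta>) (j, \<gamma>) \<le> (\<delta> ^ j - \<delta> ^ k) / (1 - \<delta>)"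
    using step.IH[OF \<beta>(1)] by blast
  have "dy_edge \<delta> I D (Suc k, \<alpha>) (k, \<beta>)"
    using \<beta> step.prems by (auto simp: dy_edge_def dy_verts_def)
  from gdist_edge[OF this] have e: "gdist (Suc k, \<alpha>) (k, \<beta>) \<le> \<delta> ^ k"
    by simp
  have "gdist (Suc k, \<alpha>) (j, \<gamma>) \<le> gdist (Suc k, \<alpha>) (k, \<beta>) + gdist (k, \<beta>) (j, \<gamma>)"
    using \<beta> \<gamma> step.prems by (intro G.triangle) (auto simp: dy_verts_def)
  also have "\<dots> \<le> \<delta> ^ k + (\<delta> ^ j - \<delta> ^ k) / (1 - \<delta>)"
    using e \<gamma>(3) by simp
  also have "\<dots> = (\<delta> ^ j - \<delta> ^ Suc k) / (1 - \<delta>)"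
    using params by (simp add: field_simps)
  finally show ?case
    using \<beta> \<gamma> by blast
qed

text \<open>Two climbs to level \<open>j\<close> and at most one horizontal edge there make up the
  constant. Level 0 needs no nearness, having a single vertex.\<close>

lemma gdist_le_scale:
  assumes u: "u \<in> verts" and v: "v \<in> verts" and "j \<le> fst u" "j \<le> fst v"
    and near: "j = 0 \<or> dist (center u) (center v) \<le> \<delta> ^ j"
  shows "gdist u v \<le> (1 + 2 / (1 - \<delta>)) * \<delta> ^ j"
proof -
  have climb: "\<exists>\<gamma>\<in>I j. dy_set D w \<subseteq> D j \<gamma> \<and> gdist w (j, \<gamma>) \<le> \<delta> ^ j / (1 - \<delta>)"
    if "w \<in> verts" "j \<le> fst w" for w
  proof -
    have "(\<delta> ^ j - \<delta> ^ fst w) / (1 - \<delta>) \<le> \<delta> ^ j / (1 - \<delta>)"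
      using params by (intro divide_right_mono) auto
    then show ?thesis
      using ancestor_exists[of "snd w" "fst w" j] that by (fastforce simp: dy_verts_def)
  qed
  obtain \<alpha> where \<alpha>: "\<alpha> \<in> I j" "dy_set D u \<subseteq> D j \<alpha>" "gdist u (j, \<alpha>) \<le> \<delta> ^ j / (1 - \<delta>)"
    using climb[of u] assms by blast
  obtain \<beta> where \<beta>: "\<beta> \<in> I j" "dy_set D v \<subseteq> D j \<beta>" "gdist v (j, \<beta>) \<le> \<delta> ^ j / (1 - \<delta>)"
    using climb[of v] assms by blast
  have V: "(j, \<alpha>) \<in> verts" "(j, \<beta>) \<in> verts"
    using \<alpha> \<beta> by (auto simp: dy_verts_def)
  have "gdist (j, \<alpha>) (j, \<beta>) \<le> \<delta> ^ j"
  proof (cases "\<alpha> = \<beta>")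
    case True
    then show ?thesis
      using V params by simp
  next
    case False
    with dyadic_root \<alpha>(1) \<beta>(1) have "j \<noteq> 0"
      by (metis singletonD)
    with near have "dist (center u) (center v) \<le> \<delta> ^ j"
      by simp
    \<comment> \<open>The points \<open>center u\<close> and \<open>center v\<close> lie in the sets
      of the two ancestors and witness the horizontal edge.\<close>
    then have "dy_edge \<delta> I D (j, \<alpha>) (j, \<beta>)"
      using False V \<alpha>(2) \<beta>(2) center_in[OF u] center_in[OF v] by (auto simp: dy_edge_def)
    from gdist_edge[OF this] show ?thesis
      by simp
  qed
  moreover have "gdist u v \<le> gdist u (j, \<alpha>) + gdist (j, \<alpha>) (j, \<beta>) + gdist v (j, \<beta>)"
    using G.triangle[OF u V(1) v] G.triangle[OF V v] G.commute[of v "(j, \<beta>)"] by linarith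
  ultimately show ?thesis
    using \<alpha>(3) \<beta>(3) by (simp add: algebra_simps)
qed

text \<open>The constant of \<open>gdist_le_scale\<close>, divided by \<delta> to pay for rounding
  the distance up to a power of \<delta>.\<close>

definition upper_const :: real where
  "upper_const = (1 + 2 / (1 - \<delta>)) / \<delta>"

lemma upper_const_pos: "0 < upper_const"
  using params by (auto simp: upper_const_def intro!: divide_pos_pos add_pos_pos)

lemma gdist_upper:
  assumes u: "u \<in> verts" and v: "v \<in> verts"
  shows "gdist u v \<le> upper_const * (dist (center u) (center v) + \<delta> ^ fst u + \<delta> ^ fst v)"
    (is "_ \<le> _ * ?r")
proof -
  define k where "k = min (fst u) (fst v)"
  have "\<delta> ^ k \<le> ?r"
    using params by (auto simp: k_def min_def)
  moreover have "\<delta> ^ Suc k < \<delta> ^ k"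
    using params by simp
  ultimately have k: "\<delta> ^ Suc k < ?r"
    by linarith
  \<comment> \<open>\<open>i\<close> is the first level whose scale is below \<open>?r\<close>. The
    two scale terms in \<open>?r\<close> force \<open>i\<close> to be at most \<open>Suc k\<close>,
    so the level just above \<open>i\<close> is no deeper than \<open>u\<close> or
    \<open>v\<close>.\<close>
  define i where "i = (LEAST i. \<delta> ^ i < ?r)"
  have i: "\<delta> ^ i < ?r" "i \<le> Suc k"
    unfolding i_def using k by (rule LeastI, rule Least_le)
  \<comment> \<open>Truncated subtraction: \<open>i = 0\<close> gives \<open>j = 0\<close>, the case
    in which \<open>gdist_le_scale\<close> asks for no nearness.\<close>
  define j where "j = i - 1"
  have "j \<le> fst u" "j \<le> fst v"
    using i(2) by (auto simp: j_def k_def)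
  moreover have "j = 0 \<or> dist (center u) (center v) \<le> \<delta> ^ j"
  proof (rule disjCI)
    \<comment> \<open>A distance exceeding \<open>\<delta> ^ j\<close> puts
      \<open>\<delta> ^ j\<close> below \<open>?r\<close>, so minimality of \<open>i\<close> gives
      \<open>i \<le> i - 1\<close>, possible only for \<open>i = 0\<close>.\<close>
    assume "\<not> dist (center u) (center v) \<le> \<delta> ^ j"
    moreover have "0 < \<delta> ^ fst u" "0 < \<delta> ^ fst v"
      using params by auto
    ultimately have "\<delta> ^ j < ?r"
      by linarith
    then have "i \<le> j"
      unfolding i_def by (rule Least_le)
    then show "j = 0"
      by (simp add: j_def)
  qed
  ultimately have "gdist u v \<le> (1 + 2 / (1 - \<delta>)) * \<delta> ^ j"
    by (rule gdist_le_scale[OF u v])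
  also have "\<dots> = upper_const * (\<delta> * \<delta> ^ j)"
    using params by (simp add: upper_const_def)
  also have "\<dots> \<le> upper_const * ?r"
  proof (rule mult_left_mono)
    have "\<delta> * \<delta> ^ j \<le> \<delta> ^ i"
      using params power_decreasing[of i "Suc j" \<delta>] by (simp add: j_def)
    with i(1) show "\<delta> * \<delta> ^ j \<le> ?r"
      by linarith
  qed (use upper_const_pos in simp)
  finally show ?thesis .
qed

text \<open>Separation bounds each of the two scale terms by the distance over \<open>a0\<close>,
  which produces \<open>2 / a0\<close>; equal indices are trivial.\<close>

lemma gdist_upper_level:
  assumes "\<alpha> \<in> I k" "\<beta> \<in> I k"
  shows "gdist (k, \<alpha>) (k, \<beta>) \<le> upper_const * (1 + 2 / a0) * dist (z k \<alpha>) (z k \<beta>)"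
proof (cases "\<alpha> = \<beta>")
  case True
  then show ?thesis
    using assms by (simp add: dy_verts_def)
next
  case False
  have "\<delta> ^ k \<le> dist (z k \<alpha>) (z k \<beta>) / a0"
    using center_separated[OF assms False] params by (simp add: field_simps)
  then have "dist (z k \<alpha>) (z k \<beta>) + \<delta> ^ k + \<delta> ^ k \<le> (1 + 2 / a0) * dist (z k \<alpha>) (z k \<beta>)"
    by (simp add: algebra_simps)
  then have "upper_const * (dist (z k \<alpha>) (z k \<beta>) + \<delta> ^ k + \<delta> ^ k)
      \<le> upper_const * ((1 + 2 / a0) * dist (z k \<alpha>) (z k \<beta>))"
    using upper_const_pos by (intro mult_left_mono) auto
  moreover have "gdist (k, \<alpha>) (k, \<beta>) \<le> upper_const * (dist (z k \<alpha>) (z k \<beta>) + \<delta> ^ k + \<delta> ^ k)"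
    using gdist_upper[of "(k, \<alpha>)" "(k, \<beta>)"] assms by (simp add: dy_verts_def)
  ultimately show ?thesis
    by (simp only: mult.assoc)
qed

section \<open>The boundary\<close>

abbreviation bdry where "bdry \<equiv> dy_boundary \<delta> I D"
abbreviation cdist where "cdist \<equiv> dy_cdist \<delta> I D"

section \<open>Cauchy sequences representing boundary points\<close>

lemma bdry_completion: "\<xi> \<in> bdry \<Longrightarrow> \<xi> \<in> completion verts gdist"
  by (simp add: completion_boundary_def)

lemma bdry_nonempty: "\<xi> \<in> bdry \<Longrightarrow> \<exists>s. s \<in> \<xi>"
  by (rule G.completion_nonempty[OF bdry_completion])

lemma bdry_MCauchy: "\<xi> \<in> bdry \<Longrightarrow> s \<in> \<xi> \<Longrightarrow> G.MCauchy s"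
  using G.completion_rel(1) bdry_completion by blast

lemma bdry_verts: "\<xi> \<in> bdry \<Longrightarrow> s \<in> \<xi> \<Longrightarrow> s n \<in> verts"
  using G.completion_in_M bdry_completion by blast

text \<open>Otherwise some late term has isolation radius at least \<open>e\<close>, while all later
  terms lie within \<open>e\<close> of it. The sequence is then eventually constant and its class is
  that of a vertex.\<close>

lemma bdry_scale_LIMSEQ:
  assumes \<xi>: "\<xi> \<in> bdry" and s: "s \<in> \<xi>"
  shows "(\<lambda>n. \<delta> ^ fst (s n)) \<longlonglongrightarrow> 0"
proof (rule LIMSEQ_I, rule ccontr)
  fix e :: real assume "0 < e" and no: "\<not> (\<exists>N. \<forall>n\<ge>N. norm (\<delta> ^ fst (s n) - 0) < e)"
  obtain N where N: "\<And>k n. \<lbrakk>N \<le> k; N \<le> n\<rbrakk> \<Longrightarrow> gdist (s k) (s n) < e"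
    using bdry_MCauchy[OF assms] \<open>0 < e\<close> unfolding G.MCauchy_def by metis
  obtain k where k: "k \<ge> N" "e \<le> \<delta> ^ fst (s k)"
    using no params by (metis abs_of_pos diff_zero linorder_not_less real_norm_def zero_less_power)
  have const: "s n = s k" if "n \<ge> N" for n
    using gdist_isolated[of "s k" "s n"] N[of k n] that k bdry_verts[OF assms] by fastforce
  have "(\<lambda>n. gdist (s n) (s k)) \<longlonglongrightarrow> 0"
    using const bdry_verts[OF assms]
    by (intro tendsto_eventually eventually_sequentiallyI[of N]) simp
  then have "\<xi> = completion_emb verts gdist (s k)"
    using G.completion_emb_mem[OF bdry_verts[OF assms]] bdry_completion[OF \<xi>] s
    by (intro G.completion_eqI[of _ _ s "\<lambda>_. s k"]) auto
  then show False
    using \<xi> bdry_verts[OF assms] by (auto simp: completion_boundary_def)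
qed

text \<open>This turns the condition defining \<open>dy_flat\<close> into convergence of
  distinguished points: the diameters of the sets shrink to 0, so it does not matter which of their
  points is followed.\<close>

lemma infdist_LIMSEQ_iff:
  assumes "\<And>n. s n \<in> verts" and scale: "(\<lambda>n. \<delta> ^ fst (s n)) \<longlonglongrightarrow> 0"
  shows "(\<lambda>n. infdist x (dy_set D (s n))) \<longlonglongrightarrow> 0 \<longleftrightarrow> (\<lambda>n. center (s n)) \<longlonglongrightarrow> x"
proof
  assume "(\<lambda>n. infdist x (dy_set D (s n))) \<longlonglongrightarrow> 0"
  then have lim: "(\<lambda>n. infdist x (dy_set D (s n)) + c4 * \<delta> ^ fst (s n)) \<longlonglongrightarrow> 0"
    using tendsto_add[OF _ tendsto_mult_left[OF scale, of c4]] by force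
  have "dist (center (s n)) x \<le> infdist x (dy_set D (s n)) + c4 * \<delta> ^ fst (s n)" for n
  proof -
    \<comment> \<open>Nonemptiness makes \<open>infdist\<close> a genuine infimum instead of its
      default value 0.\<close>
    have ne: "dy_set D (s n) \<noteq> {}"
      using center_in[OF assms(1)] by blast
    have "dist (center (s n)) x - c4 * \<delta> ^ fst (s n) \<le> infdist x (dy_set D (s n))"
      unfolding infdist_notempty[OF ne]
    proof (rule cINF_greatest)
      show "dy_set D (s n) \<noteq> {}"
        by (rule ne)
      fix y assume "y \<in> dy_set D (s n)"
      then show "dist (center (s n)) x - c4 * \<delta> ^ fst (s n) \<le> dist x y"
        using dist_triangle[of "center (s n)" x y] dist_le_diam[OF assms(1), of "center (s n)" n y]
          center_in[OF assms(1), of n] by (simp add: dist_commute)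
    qed
    then show ?thesis
      by simp
  qed
  then have "(\<lambda>n. dist (center (s n)) x) \<longlonglongrightarrow> 0"
    by (intro Lim_null_comparison[OF always_eventually lim]) simp
  then show "(\<lambda>n. center (s n)) \<longlonglongrightarrow> x"
    by (simp add: tendsto_dist_iff[of _ x])
next
  assume "(\<lambda>n. center (s n)) \<longlonglongrightarrow> x"
  then have lim: "(\<lambda>n. dist x (center (s n))) \<longlonglongrightarrow> 0"
    by (simp add: tendsto_dist_iff[of _ x] dist_commute)
  show "(\<lambda>n. infdist x (dy_set D (s n))) \<longlonglongrightarrow> 0"
    using infdist_le[OF center_in[OF assms(1)]]
    by (intro Lim_null_comparison[OF always_eventually lim]) (simp add: infdist_nonneg)
qed

lemma center_Cauchy:
  assumes "G.MCauchy s"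
  shows "Cauchy (\<lambda>n. center (s n))"
proof (rule metric_CauchyI)
  fix e :: real assume "0 < e"
  then have "0 < e / (2 * c4 + 1)"
    using params by simp
  then obtain N where N: "\<And>k n. \<lbrakk>N \<le> k; N \<le> n\<rbrakk> \<Longrightarrow> gdist (s k) (s n) < e / (2 * c4 + 1)"
    using assms unfolding G.MCauchy_def by metis
  have "dist (center (s k)) (center (s n)) < e" if "N \<le> k" "N \<le> n" for k n
  proof -
    have "s k \<in> verts" "s n \<in> verts"
      using assms by (auto simp: G.MCauchy_def)
    then show ?thesis
      using center_lipschitz[of "s k" "s n"] N[OF that] params by (simp add: field_simps)
  qed
  then show "\<exists>N. \<forall>k\<ge>N. \<forall>n\<ge>N. dist (center (s k)) (center (s n)) < e"
    by blast
qed

text \<open>Completeness of the space gives a limit for one representative, and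
  \<open>center_lipschitz\<close> carries it over to all others; so the definite description in
  \<open>dy_flat\<close> is met by exactly this point.\<close>

lemma center_LIMSEQ_flat:
  assumes \<xi>: "\<xi> \<in> bdry" and s: "s \<in> \<xi>"
  shows "(\<lambda>n. center (s n)) \<longlonglongrightarrow> dy_flat D \<xi>"
proof -
  obtain x where x: "(\<lambda>n. center (s n)) \<longlonglongrightarrow> x"
    using center_Cauchy[OF bdry_MCauchy[OF assms]] Cauchy_convergent convergentD by blast
  have lim: "(\<lambda>n. center (t n)) \<longlonglongrightarrow> x" if t: "t \<in> \<xi>" for t
  proof -
    have "(\<lambda>n. (2 * c4 + 1) * gdist (s n) (t n)) \<longlonglongrightarrow> 0"
      using G.completion_rel(2)[OF bdry_completion[OF \<xi>] s t] by (rule tendsto_mult_right_zero)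
    then have "(\<lambda>n. dist (center (s n)) (center (t n))) \<longlonglongrightarrow> 0"
      by (rule Lim_null_comparison[OF always_eventually, rotated])
        (simp add: center_lipschitz bdry_verts[OF \<xi> s] bdry_verts[OF \<xi> t])
    then have "(\<lambda>n. dist (center (s n)) (center (t n)) + dist (center (s n)) x) \<longlonglongrightarrow> 0"
      using x by (intro tendsto_add_zero) (simp_all add: tendsto_dist_iff[of _ x])
    then have "(\<lambda>n. dist (center (t n)) x) \<longlonglongrightarrow> 0"
      by (rule Lim_null_comparison[OF always_eventually, rotated]) (simp add: dist_triangle3)
    then show ?thesis
      by (simp add: tendsto_dist_iff[of _ x])
  qed
  have *: "(\<lambda>n. infdist y (dy_set D (t n))) \<longlonglongrightarrow> 0 \<longleftrightarrow> (\<lambda>n. center (t n)) \<longlonglongrightarrow> y" if "t \<in> \<xi>" for t y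
    using that by (intro infdist_LIMSEQ_iff bdry_verts[OF \<xi>] bdry_scale_LIMSEQ[OF \<xi>])
  have "dy_flat D \<xi> = x"
    unfolding dy_flat_def
  proof (rule the_equality)
    show "\<forall>t\<in>\<xi>. (\<lambda>n. infdist x (dy_set D (t n))) \<longlonglongrightarrow> 0"
      using * lim by blast
  next
    fix y assume "\<forall>t\<in>\<xi>. (\<lambda>n. infdist y (dy_set D (t n))) \<longlonglongrightarrow> 0"
    with *[OF s] s have "(\<lambda>n. center (s n)) \<longlonglongrightarrow> y"
      by blast
    then show "y = x"
      using x by (rule LIMSEQ_unique)
  qed
  with x show ?thesis
    by simp
qed

section \<open>Bi-Lipschitz bounds and bijectivity on the boundary, by passing to limits\<close>

lemma cdist_lower:
  assumes "\<xi> \<in> bdry" "\<eta> \<in> bdry"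
  shows "dist (dy_flat D \<xi>) (dy_flat D \<eta>) \<le> (2 * c4 + 1) * cdist \<xi> \<eta>"
proof -
  obtain s t where st: "s \<in> \<xi>" "t \<in> \<eta>"
    using assms bdry_nonempty by blast
  show ?thesis
  proof (rule LIMSEQ_le)
    show "(\<lambda>n. dist (center (s n)) (center (t n))) \<longlonglongrightarrow> dist (dy_flat D \<xi>) (dy_flat D \<eta>)"
      using assms st by (intro tendsto_dist center_LIMSEQ_flat)
    show "(\<lambda>n. (2 * c4 + 1) * gdist (s n) (t n)) \<longlonglongrightarrow> (2 * c4 + 1) * cdist \<xi> \<eta>"
      using assms st by (intro tendsto_mult_left G.completion_dist_LIMSEQ bdry_completion)
    show "\<exists>N. \<forall>n\<ge>N. dist (center (s n)) (center (t n)) \<le> (2 * c4 + 1) * gdist (s n) (t n)"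
      using assms st bdry_verts center_lipschitz by blast
  qed
qed

lemma cdist_upper:
  assumes \<xi>: "\<xi> \<in> bdry" and \<eta>: "\<eta> \<in> bdry"
  shows "cdist \<xi> \<eta> \<le> upper_const * dist (dy_flat D \<xi>) (dy_flat D \<eta>)"
proof -
  obtain s t where st: "s \<in> \<xi>" "t \<in> \<eta>"
    using assms bdry_nonempty by blast
  show ?thesis
  proof (rule LIMSEQ_le)
    show "(\<lambda>n. gdist (s n) (t n)) \<longlonglongrightarrow> cdist \<xi> \<eta>"
      using assms st by (intro G.completion_dist_LIMSEQ bdry_completion)
    have "(\<lambda>n. upper_const *
            (dist (center (s n)) (center (t n)) + \<delta> ^ fst (s n) + \<delta> ^ fst (t n)))
          \<longlonglongrightarrow> upper_const * (dist (dy_flat D \<xi>) (dy_flat D \<eta>) + 0 + 0)"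
      using assms st
      by (intro tendsto_mult_left tendsto_add tendsto_dist center_LIMSEQ_flat bdry_scale_LIMSEQ)
    then show "(\<lambda>n. upper_const *
            (dist (center (s n)) (center (t n)) + \<delta> ^ fst (s n) + \<delta> ^ fst (t n)))
          \<longlonglongrightarrow> upper_const * dist (dy_flat D \<xi>) (dy_flat D \<eta>)"
      by simp
    show "\<exists>N. \<forall>n\<ge>N. gdist (s n) (t n)
        \<le> upper_const * (dist (center (s n)) (center (t n)) + \<delta> ^ fst (s n) + \<delta> ^ fst (t n))"
      using bdry_verts[OF \<xi> st(1)] bdry_verts[OF \<eta> st(2)] gdist_upper by blast
  qed
qed

text \<open>Equal images force completion distance 0 by the upper bound, and classes at distance 0
  coincide.\<close>

lemma flat_inj: "inj_on (dy_flat D) bdry"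
proof (rule inj_onI)
  fix \<xi> \<eta> assume \<xi>: "\<xi> \<in> bdry" and \<eta>: "\<eta> \<in> bdry" and eq: "dy_flat D \<xi> = dy_flat D \<eta>"
  obtain s t where st: "s \<in> \<xi>" "t \<in> \<eta>"
    using \<xi> \<eta> bdry_nonempty by blast
  have lim: "(\<lambda>n. gdist (s n) (t n)) \<longlonglongrightarrow> cdist \<xi> \<eta>"
    using \<xi> \<eta> st by (intro G.completion_dist_LIMSEQ bdry_completion)
  then have "0 \<le> cdist \<xi> \<eta>"
    by (rule LIMSEQ_le_const) simp
  with cdist_upper[OF \<xi> \<eta>] eq have "cdist \<xi> \<eta> = 0"
    by simp
  with lim show "\<xi> = \<eta>"
    using \<xi> \<eta> st by (intro G.completion_eqI[of _ _ s t] bdry_completion) auto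
qed

text \<open>The preimage is the class of a sequence with one vertex per level, its set within
  \<open>\<delta> ^ n\<close> of \<open>x\<close>. Nearness replaces membership because
  \<open>x\<close> may lie outside every set of a level.\<close>

lemma flat_surj: "\<exists>\<xi>\<in>bdry. dy_flat D \<xi> = x"
proof -
  have "\<exists>\<alpha>. \<alpha> \<in> I n \<and> (\<exists>y\<in>D n \<alpha>. dist x y < \<delta> ^ n)" for n
    using dyadic_dense[of "\<delta> ^ n" n x] params by auto
  then obtain a where a: "\<And>n. a n \<in> I n" "\<And>n. \<exists>y\<in>D n (a n). dist x y < \<delta> ^ n"
    by metis
  define s where "s n = (n, a n)" for n
  have s_verts: "s n \<in> verts" for n
    using a(1) by (simp add: s_def dy_verts_def)
  have close: "dist (center (s n)) x \<le> (c4 + 1) * \<delta> ^ n" for n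
  proof -
    obtain y where y: "y \<in> D n (a n)" "dist x y < \<delta> ^ n"
      using a(2) by blast
    then have "dist (center (s n)) y \<le> c4 * \<delta> ^ n"
      using dist_le_diam[OF s_verts, of "center (s n)" n y] center_in[OF s_verts, of n]
      by (simp add: s_def)
    with y(2) show ?thesis
      using dist_triangle[of "center (s n)" x y] by (simp add: dist_commute algebra_simps)
  qed
  have pow0: "(\<lambda>n. \<delta> ^ n) \<longlonglongrightarrow> 0"
    using params by (intro LIMSEQ_power_zero) simp
  from pow0 have "(\<lambda>n. (c4 + 1) * \<delta> ^ n) \<longlonglongrightarrow> 0"
    by (rule tendsto_mult_right_zero)
  then have "(\<lambda>n. dist (center (s n)) x) \<longlonglongrightarrow> 0"
    by (rule Lim_null_comparison[OF always_eventually, rotated]) (simp add: close)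
  then have center_lim: "(\<lambda>n. center (s n)) \<longlonglongrightarrow> x"
    by (simp add: tendsto_dist_iff[of _ x])
  \<comment> \<open>Going through \<open>x\<close> costs \<open>c4 + 1\<close> times each scale, and
    the scale terms of \<open>gdist_upper\<close> add 1.\<close>
  define K where "K = upper_const * (c4 + 2)"
  have K: "0 < K"
    using upper_const_pos params by (simp add: K_def)
  have gd: "gdist (s k) (s n) \<le> K * (\<delta> ^ k + \<delta> ^ n)" for k n
  proof -
    have "dist (center (s k)) (center (s n)) + \<delta> ^ k + \<delta> ^ n \<le> (c4 + 2) * (\<delta> ^ k + \<delta> ^ n)"
      using dist_triangle[of "center (s k)" "center (s n)" x] close[of k] close[of n]
      by (simp add: dist_commute algebra_simps)
    then have "upper_const * (dist (center (s k)) (center (s n)) + \<delta> ^ k + \<delta> ^ n)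
        \<le> K * (\<delta> ^ k + \<delta> ^ n)"
      unfolding K_def mult.assoc using upper_const_pos by (intro mult_left_mono) auto
    with gdist_upper[OF s_verts s_verts, of k n] show ?thesis
      by (simp add: s_def)
  qed
  have cau: "G.MCauchy s"
    unfolding G.MCauchy_def
  proof (intro conjI allI impI)
    show "range s \<subseteq> verts"
      using s_verts by blast
    fix e :: real assume "0 < e"
    then have "0 < e / (2 * K)"
      using K by simp
    with pow0 have "\<forall>\<^sub>F n in sequentially. \<delta> ^ n < e / (2 * K)"
      by (rule order_tendstoD)
    then obtain N where N: "\<And>n. n \<ge> N \<Longrightarrow> \<delta> ^ n < e / (2 * K)"
      unfolding eventually_sequentially by blast
    have "gdist (s k) (s n) < e" if "N \<le> k" "N \<le> n" for k n
    proof -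
      have "\<delta> ^ k + \<delta> ^ n < e / K"
        using N[OF that(1)] N[OF that(2)] by (simp add: field_simps)
      then show ?thesis
        using gd[of k n] K by (simp add: field_simps)
    qed
    then show "\<exists>N. \<forall>k n. N \<le> k \<longrightarrow> N \<le> n \<longrightarrow> gdist (s k) (s n) < e"
      by blast
  qed
  define \<xi> where "\<xi> = cauchy_rel verts gdist `` {s}"
  have \<xi>: "\<xi> \<in> completion verts gdist" "s \<in> \<xi>"
    unfolding \<xi>_def using G.completion_classI[OF cau] by auto
  \<comment> \<open>Beyond the level of \<open>v\<close> the sequence never meets \<open>v\<close>,
    so isolation keeps it at distance at least \<open>\<delta> ^ fst v\<close>.\<close>
  have "\<xi> \<noteq> completion_emb verts gdist v" if v: "v \<in> verts" for v
  proof
    assume "\<xi> = completion_emb verts gdist v"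
    then have lim: "(\<lambda>n. gdist v (s n)) \<longlonglongrightarrow> 0"
      using G.completion_rel(2)[OF \<xi>(1) _ \<xi>(2), of "\<lambda>_. v"] G.completion_emb_mem[OF v] by simp
    have "\<delta> ^ fst v \<le> gdist v (s n)" if "n \<ge> Suc (fst v)" for n
      using that by (intro gdist_isolated v s_verts) (auto simp: s_def)
    then have "\<delta> ^ fst v \<le> 0"
      by (intro LIMSEQ_le_const[OF lim]) blast
    then show False
      using zero_less_power[OF params(1), of "fst v"] by simp
  qed
  with \<xi>(1) have "\<xi> \<in> bdry"
    by (auto simp: completion_boundary_def)
  moreover from center_LIMSEQ_flat[OF this \<xi>(2)] center_lim have "dy_flat D \<xi> = x"
    by (rule LIMSEQ_unique)
  ultimately show ?thesis
    by blast
qed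

lemma flat_bij: "bij_betw (dy_flat D) bdry UNIV"
  using flat_inj flat_surj by (auto simp: bij_betw_def) (metis imageI)

end

text \<open>Bijectivity is part of the conclusion because \<open>dy_flat\<close> is given by a
  definite description, whose good behaviour is thereby proved as well.\<close>

theorem theorem10:
  fixes m :: "'a::complete_space measure"
    and c1 c2 q \<delta> a0 c4 :: real
    and I :: "nat \<Rightarrow> 'i set"
    and D :: "nat \<Rightarrow> 'i \<Rightarrow> 'a set"
    and z :: "nat \<Rightarrow> 'i \<Rightarrow> 'a"
  assumes "ahlfors_regular m c1 c2 q"
    and "dyadic_system m \<delta> a0 c4 I D z"
  shows "bij_betw (dy_flat D) (dy_boundary \<delta> I D) UNIV \<and>
    (\<exists>c C. 0 < c \<and> c \<le> C \<and>
      (\<forall>\<xi>\<in>dy_boundary \<delta> I D. \<forall>\<eta>\<in>dy_boundary \<delta> I D.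
         c * dist (dy_flat D \<xi>) (dy_flat D \<eta>) \<le> dy_cdist \<delta> I D \<xi> \<eta> \<and>
         dy_cdist \<delta> I D \<xi> \<eta> \<le> C * dist (dy_flat D \<xi>) (dy_flat D \<eta>)) \<and>
      (\<forall>k. \<forall>\<alpha>\<in>I k. \<forall>\<beta>\<in>I k.
         c * dist (z k \<alpha>) (z k \<beta>) \<le> dy_dist \<delta> I D (k, \<alpha>) (k, \<beta>) \<and>
         dy_dist \<delta> I D (k, \<alpha>) (k, \<beta>) \<le> C * dist (z k \<alpha>) (z k \<beta>)))"
proof -
  interpret dyadic_space m c1 c2 q \<delta> a0 c4 I D z
    using assms by unfold_locales
  define c where "c = 1 / (2 * c4 + 1)"
  \<comment> \<open>The maximum with \<open>c\<close> secures \<open>c \<le> C\<close>. The other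
    entry is the constant for a single level, which dominates \<open>upper_const\<close>, the
    constant for the boundary.\<close>
  define C where "C = max c (upper_const * (1 + 2 / a0))"
  have c: "0 < c"
    using params by (simp add: c_def)
  have lower: "c * r \<le> d" if "r \<le> (2 * c4 + 1) * d" for r d :: real
    using that params by (simp add: c_def field_simps)
  have C: "upper_const * (1 + 2 / a0) * dist x y \<le> C * dist x y" for x y :: 'a
    unfolding C_def by (intro mult_right_mono) auto
  have "upper_const * dist x y \<le> upper_const * (1 + 2 / a0) * dist x y" for x y :: 'a
    using params upper_const_pos by (intro mult_right_mono) (simp_all add: field_simps)
  note C' = order_trans[OF this C]
  show ?thesis
  proof (rule conjI[OF flat_bij], rule exI[of _ c], rule exI[of _ C], intro conjI ballI allI)
    show "0 < c" "c \<le> C"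
      using c by (auto simp: C_def)
  next
    fix \<xi> \<eta> assume "\<xi> \<in> bdry" "\<eta> \<in> bdry"
    then show "c * dist (dy_flat D \<xi>) (dy_flat D \<eta>) \<le> cdist \<xi> \<eta>"
      "cdist \<xi> \<eta> \<le> C * dist (dy_flat D \<xi>) (dy_flat D \<eta>)"
      using lower cdist_lower cdist_upper order_trans[OF _ C'] by auto
  next
    fix k \<alpha> \<beta> assume "\<alpha> \<in> I k" "\<beta> \<in> I k"
    then show "c * dist (z k \<alpha>) (z k \<beta>) \<le> gdist (k, \<alpha>) (k, \<beta>)"
      "gdist (k, \<alpha>) (k, \<beta>) \<le> C * dist (z k \<alpha>) (z k \<beta>)"
      using lower center_lipschitz[of "(k, \<alpha>)" "(k, \<beta>)"] order_trans[OF gdist_upper_level C]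
      by (auto simp: dy_verts_def)
  qed
qed

end
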